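(* Let $p\in(1/2,1)$ be a fixed constant. Suppose there exists an oriented graph with no Seymour vertex. Then, asymptotically almost surely (i.e., with probability tending to $1$ as $n\to\infty$), the random graph $G\sim G(n,p)$ has an orientation with no Seymour vertex.
   Context: All graphs are finite and simple. $G(n,p)$ denotes the binomial random graph on $n$ vertices in which each possible edge is present independently with probability $p$. For a digraph $D$ and $v\in V(D)$, the outneighbourhood is $N_1(v)=\{w\in V(D)\setminus\{v\}: vw\in E(D)\}$, and the second outneighbourhood is $N_2(v)=\{w\in V(D)\setminus(\{v\}\cup N_1(v)): \text{there is an edge from some vertex of } N_1(v) \text{ to } w\}$. A vertex $v$ is a Seymour vertex if $|N_2(v)|\ge |N_1(v)|$. (Seymour's conjecture asserts that every oriented graph has a Seymour vertex; the hypothesis here is that this conjecture is false.) *)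

theory Defs
  imports
    "HOL-Probability.Probability"
    "HOL-Library.Ramsey"
    "Graph_Theory.Pair_Digraph"
begin

text \<open>
  As in \<^theory>\<open>Graph_Theory.Pair_Digraph\<close>, a finite simple graph is a \<^const>\<open>pair_graph\<close>: a finite
  loop-free digraph whose arc relation is symmetric, an edge \<open>uv\<close> being the two arcs \<open>(u, v)\<close> and
  \<open>(v, u)\<close>.
\<close>

definition oriented_graph :: "'a pair_pre_digraph \<Rightarrow> bool" where
  "oriented_graph D \<longleftrightarrow> pair_digraph D \<and> asym (parcs D)"

definition orientation_of :: "'a pair_pre_digraph \<Rightarrow> 'a pair_pre_digraph \<Rightarrow> bool" where
  "orientation_of G D \<longleftrightarrow>
     oriented_graph D \<and> pverts D = pverts G \<and> parcs D \<union> (parcs D)\<inverse> = parcs G"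

definition out_nbhd :: "'a pair_pre_digraph \<Rightarrow> 'a \<Rightarrow> 'a set" where
  "out_nbhd D v = {w \<in> pverts D - {v}. (v, w) \<in> parcs D}"

definition second_out_nbhd :: "'a pair_pre_digraph \<Rightarrow> 'a \<Rightarrow> 'a set" where
  "second_out_nbhd D v =
     {w \<in> pverts D - ({v} \<union> out_nbhd D v). \<exists>u \<in> out_nbhd D v. (u, w) \<in> parcs D}"

definition Seymour_vertex :: "'a pair_pre_digraph \<Rightarrow> 'a \<Rightarrow> bool" where
  "Seymour_vertex D v \<longleftrightarrow>
     v \<in> pverts D \<and> card (second_out_nbhd D v) \<ge> card (out_nbhd D v)"

definition binomial_random_graph :: "nat \<Rightarrow> real \<Rightarrow> nat pair_pre_digraph pmf" where
  "binomial_random_graph n p =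
     map_pmf (\<lambda>f. \<lparr>pverts = {..<n}, parcs = {(u, v). {u, v} \<in> nsets {..<n} 2 \<and> f {u, v}}\<rparr>)
       (Pi_pmf (nsets {..<n} 2) False (\<lambda>_. bernoulli_pmf p))"

lemma pair_graph_binomial_random_graph:
  assumes "G \<in> set_pmf (binomial_random_graph n p)"
  shows "pair_graph G"
proof -
  obtain f where G: "G = \<lparr>pverts = {..<n},
      parcs = {(u, v). {u, v} \<in> nsets {..<n} 2 \<and> f {u, v}}\<rparr>"
    using assms by (auto simp: binomial_random_graph_def)
  have "parcs G \<subseteq> {..<n} \<times> {..<n}"
    by (auto simp: G nsets_def)
  then have "finite (parcs G)"
    by (rule finite_subset) simp
  moreover have "symmetric (with_proj G)"
    by (auto simp: symmetric_def G insert_commute intro!: symI)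
  ultimately show ?thesis
    by unfold_locales (auto simp: G nsets_def)
qed

end

theory Submission
  imports Defs "HOL-Real_Asymp.Real_Asymp"
begin

text \<open>
  Suppose that an induced subgraph \<open>G[S]\<close> has an orientation without Seymour vertex and that a
  vertex \<open>v\<close> outside \<open>S\<close> is adjacent to more than half of \<open>S\<close>. Orienting all edges between \<open>v\<close> and
  \<open>S\<close> towards \<open>S\<close> changes nothing for the vertices of \<open>S\<close>, and \<open>v\<close> is not a Seymour vertex, because
  its second outneighbourhood lies in the less than half of \<open>S\<close> it is not adjacent to. By averaging,
  such a \<open>v\<close> exists whenever more than half of the pairs in the cut between \<open>S\<close> and its complement are
  edges. Since \<open>p > 1/2\<close>, Hoeffding's inequality and a union bound show that a.a.s. this holds for all
  cuts of the random graph simultaneously, so the orientation grows to all of \<open>G\<close> from any nonempty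
  \<open>S\<close>. To start, cut the vertex set into blocks of the size of the given counterexample: a.a.s.
  one of the linearly many independent blocks induces a copy of its underlying graph.
\<close>

section \<open>Extending orientations vertex by vertex\<close>

definition induced :: "'a pair_pre_digraph \<Rightarrow> 'a set \<Rightarrow> 'a pair_pre_digraph" where
  "induced G S = \<lparr>pverts = S, parcs = parcs G \<inter> S \<times> S\<rparr>"

definition Seymour_free_orientable :: "'a pair_pre_digraph \<Rightarrow> bool" where
  "Seymour_free_orientable G \<longleftrightarrow> (\<exists>D. orientation_of G D \<and> \<not> (\<exists>v. Seymour_vertex D v))"

text \<open>Only arcs from the complement into \<open>S\<close> are counted, so an edge of a simple
  graph across the cut counts once; the cut then has density above 1/2, stated without
  division.\<close>

definition dense_cuts :: "'a pair_pre_digraph \<Rightarrow> bool" where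
  "dense_cuts G \<longleftrightarrow> (\<forall>S. S \<subset> pverts G \<longrightarrow> S \<noteq> {} \<longrightarrow>
     card (pverts G - S) * card S < 2 * card (parcs G \<inter> (pverts G - S) \<times> S))"

text \<open>Asymmetry excludes loops, and finitely many vertices leave only finitely many
  arcs.\<close>

lemma oriented_graph_iff:
  "oriented_graph D \<longleftrightarrow>
     finite (pverts D) \<and> parcs D \<subseteq> pverts D \<times> pverts D \<and> asym (parcs D)"
proof
  assume D: "oriented_graph D"
  then interpret pair_digraph D
    by (simp add: oriented_graph_def)
  show "finite (pverts D) \<and> parcs D \<subseteq> pverts D \<times> pverts D \<and> asym (parcs D)"
    using D pair_finite_verts in_arcsD1 in_arcsD2 by (auto simp: oriented_graph_def)
next
  assume D: "finite (pverts D) \<and> parcs D \<subseteq> pverts D \<times> pverts D \<and> asym (parcs D)"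
  then have "finite (parcs D)"
    by (meson finite_SigmaI finite_subset)
  with D have "pair_digraph D"
    by unfold_locales (auto dest: asymD)
  with D show "oriented_graph D"
    by (simp add: oriented_graph_def)
qed

lemma Seymour_free_orientable_insert:
  assumes G: "sym (parcs G)" "irrefl (parcs G)"
    and v: "v \<notin> S"
    and S: "Seymour_free_orientable (induced G S)"
    and deg: "card S < 2 * card {u \<in> S. (v, u) \<in> parcs G}"
  shows "Seymour_free_orientable (induced G (insert v S))"
proof -
  define N where "N = {u \<in> S. (v, u) \<in> parcs G}"
  obtain D where D: "orientation_of (induced G S) D" and noS: "\<And>u. \<not> Seymour_vertex D u"
    using S by (auto simp: Seymour_free_orientable_def)
  have V: "pverts D = S" and arcs: "parcs D \<union> (parcs D)\<inverse> = parcs G \<inter> S \<times> S"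
    and fin: "finite S" and sub: "parcs D \<subseteq> S \<times> S" and asym: "asym (parcs D)"
    using D by (auto simp: orientation_of_def induced_def oriented_graph_iff)
  \<comment> \<open>The new vertex becomes a source: every arc at \<open>v\<close> points into
    \<open>S\<close>.\<close>
  define D' where "D' = \<lparr>pverts = insert v S, parcs = parcs D \<union> {v} \<times> N\<rparr>"
  have V': "pverts D' = insert v S" and arcs': "parcs D' = parcs D \<union> {v} \<times> N"
    by (auto simp: D'_def)
  have "asym (parcs D')"
    using v sub by (auto simp: arcs' N_def intro!: asymI dest: asymD[OF asym])
  then have "oriented_graph D'"
    using fin sub by (auto simp: oriented_graph_iff V' arcs' N_def)
  moreover have "parcs D' \<union> (parcs D')\<inverse> = parcs (induced G (insert v S))"
  proof -
    have "parcs D' \<union> (parcs D')\<inverse> = (parcs G \<inter> S \<times> S) \<union> {v} \<times> N \<union> N \<times> {v}"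
      unfolding arcs' arcs[symmetric] by auto
    also have "\<dots> = parcs (induced G (insert v S))"
      using G by (auto simp: N_def induced_def irrefl_def dest: symD)
    finally show ?thesis .
  qed
  ultimately have "orientation_of (induced G (insert v S)) D'"
    by (simp add: orientation_of_def V' induced_def)
  moreover have "\<not> Seymour_vertex D' u" for u
  proof (cases "u = v")
    case True
    have out: "out_nbhd D' v = N"
      using v sub by (auto simp: out_nbhd_def V' arcs' N_def)
    \<comment> \<open>Nothing outside \<open>insert v S\<close> exists, and both \<open>v\<close>
      and its outneighbours \<open>N\<close> are excluded.\<close>
    have "second_out_nbhd D' v \<subseteq> S - N"
      using out by (auto simp: second_out_nbhd_def V')
    then have "card (second_out_nbhd D' v) \<le> card (S - N)"
      using fin by (intro card_mono) auto
    also have "\<dots> = card S - card N"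
      using fin by (intro card_Diff_subset) (auto simp: N_def)
    also have "\<dots> < card N"
      using deg by (simp add: N_def)
    finally show ?thesis
      using True out by (simp add: Seymour_vertex_def)
  next
    case False
    have out: "out_nbhd D' u = out_nbhd D u"
      using False sub v by (auto simp: out_nbhd_def V V' arcs')
    \<comment> \<open>The only new arcs start at \<open>v\<close>, which \<open>u\<close> does not
      reach, so two steps from \<open>u\<close> see only \<open>D\<close>.\<close>
    have "v \<notin> out_nbhd D u"
      using v by (auto simp: out_nbhd_def V)
    then have "second_out_nbhd D' u = second_out_nbhd D u"
      using sub v unfolding second_out_nbhd_def out by (auto simp: V V' arcs')
    then show ?thesis
      using noS[of u] False by (auto simp: Seymour_vertex_def out V V')
  qed
  ultimately show ?thesis
    by (auto simp: Seymour_free_orientable_def)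
qed

text \<open>Double counting: the arcs of the cut are the sum of the degrees into \<open>S\<close>.
  If no degree exceeded half of \<open>S\<close>, neither would the density of the cut exceed
  1/2.\<close>

lemma dense_cuts_obtain:
  assumes "dense_cuts G" "finite (pverts G)" "S \<subset> pverts G" "S \<noteq> {}"
  obtains v where "v \<in> pverts G - S" "card S < 2 * card {u \<in> S. (v, u) \<in> parcs G}"
proof -
  let ?W = "pverts G - S"
  have "parcs G \<inter> ?W \<times> S = (SIGMA v:?W. {u \<in> S. (v, u) \<in> parcs G})"
    by auto
  moreover have fin: "finite S" "finite ?W"
    using assms finite_subset by auto
  ultimately have card: "card (parcs G \<inter> ?W \<times> S) = (\<Sum>v\<in>?W. card {u \<in> S. (v, u) \<in> parcs G})"
    by simp
  have "card ?W * card S < 2 * card (parcs G \<inter> ?W \<times> S)"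
    using assms by (simp add: dense_cuts_def)
  then have "(\<Sum>v\<in>?W. card S) < (\<Sum>v\<in>?W. 2 * card {u \<in> S. (v, u) \<in> parcs G})"
    unfolding card by (simp flip: sum_distrib_left)
  then have "\<exists>v\<in>?W. card S < 2 * card {u \<in> S. (v, u) \<in> parcs G}"
    by (metis (no_types, lifting) linorder_not_le sum_mono)
  with that show ?thesis
    by blast
qed

lemma Seymour_free_orientable_if_dense_cuts:
  assumes G: "pair_graph G" and dense: "dense_cuts G"
    and S: "S \<subseteq> pverts G" "S \<noteq> {}" "Seymour_free_orientable (induced G S)"
  shows "Seymour_free_orientable G"
proof -
  interpret pair_graph G by fact
  have sym: "sym (parcs G)"
    using pair_sym_arcs by (simp add: symmetric_def)
  have irrefl: "irrefl (parcs G)"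
    using pair_no_loops by (force simp: irrefl_def)
  from S show ?thesis
  proof (induction "card (pverts G - S)" arbitrary: S rule: less_induct)
    case less
    show ?case
    proof (cases "S = pverts G")
      case True
      moreover have "induced G (pverts G) = G"
        using in_arcsD1 in_arcsD2 by (cases G) (auto simp: induced_def)
      ultimately show ?thesis
        using less.prems by simp
    next
      case False
      then obtain v where v: "v \<in> pverts G - S" "card S < 2 * card {u \<in> S. (v, u) \<in> parcs G}"
        using dense_cuts_obtain[OF dense pair_finite_verts] less.prems by blast
      have "card (pverts G - insert v S) < card (pverts G - S)"
        using v pair_finite_verts by (intro psubset_card_mono) auto
      then show ?thesis
        using less.hyps v less.prems Seymour_free_orientable_insert[OF sym irrefl _ less.prems(3) v(2)]
        by blast
    qed
  qed
qed

text \<open>The orientation is carried over along \<open>h\<close>. As \<open>emb\<close> is an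
  equivalence, the copy is induced and no further edge needs orienting; injectivity preserves the
  sizes of both neighbourhoods.\<close>

lemma Seymour_free_orientable_embedding:
  assumes D: "oriented_graph D" "\<not> (\<exists>v. Seymour_vertex D v)"
    and h: "inj_on h (pverts D)"
    and emb: "\<And>x y. x \<in> pverts D \<Longrightarrow> y \<in> pverts D \<Longrightarrow>
      (h x, h y) \<in> parcs G \<longleftrightarrow> (x, y) \<in> parcs D \<or> (y, x) \<in> parcs D"
  shows "Seymour_free_orientable (induced G (h ` pverts D))"
proof -
  let ?V = "pverts D"
  define D' where "D' = \<lparr>pverts = h ` ?V, parcs = map_prod h h ` parcs D\<rparr>"
  have fin: "finite ?V" and sub: "parcs D \<subseteq> ?V \<times> ?V" and asym: "asym (parcs D)"
    using D by (auto simp: oriented_graph_iff)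
  have V': "pverts D' = h ` ?V" and sub': "parcs D' \<subseteq> h ` ?V \<times> h ` ?V"
    using sub by (auto simp: D'_def)
  have inj: "h x = h y \<longleftrightarrow> x = y" if "x \<in> ?V" "y \<in> ?V" for x y
    using that h by (auto simp: inj_on_def)
  have arcs': "(h x, h y) \<in> parcs D' \<longleftrightarrow> (x, y) \<in> parcs D" if "x \<in> ?V" "y \<in> ?V" for x y
  proof
    assume "(h x, h y) \<in> parcs D'"
    then obtain a b where "(a, b) \<in> parcs D" "h x = h a" "h y = h b"
      by (auto simp: D'_def)
    then show "(x, y) \<in> parcs D"
      using that sub inj by auto
  qed (force simp: D'_def)
  have "asym (parcs D')"
    using sub' asymD[OF asym] arcs' by (intro asymI) (smt (verit) imageE mem_Sigma_iff subset_iff)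
  then have "oriented_graph D'"
    using fin sub' by (simp add: oriented_graph_iff V')
  moreover have "parcs D' \<union> (parcs D')\<inverse> = parcs (induced G (h ` ?V))"
  proof (intro set_eqI iffI)
    fix e assume "e \<in> parcs D' \<union> (parcs D')\<inverse>"
    moreover from this obtain x y where "e = (h x, h y)" "x \<in> ?V" "y \<in> ?V"
      using sub' by auto
    ultimately show "e \<in> parcs (induced G (h ` ?V))"
      using arcs' emb by (auto simp: induced_def)
  next
    fix e assume "e \<in> parcs (induced G (h ` ?V))"
    moreover from this obtain x y where "e = (h x, h y)" "x \<in> ?V" "y \<in> ?V"
      by (auto simp: induced_def)
    ultimately show "e \<in> parcs D' \<union> (parcs D')\<inverse>"
      using arcs' emb by (auto simp: induced_def)
  qed
  ultimately have "orientation_of (induced G (h ` ?V)) D'"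
    by (simp add: orientation_of_def V' induced_def)
  moreover have "\<not> Seymour_vertex D' w" for w
  proof
    assume w: "Seymour_vertex D' w"
    then obtain x where x: "x \<in> ?V" "w = h x"
      by (auto simp: Seymour_vertex_def V')
    have out: "out_nbhd D' (h x) = h ` out_nbhd D x"
      using x by (auto simp: out_nbhd_def V' arcs' inj)
    have sub_out: "out_nbhd D x \<subseteq> ?V"
      by (auto simp: out_nbhd_def)
    have mem: "h y \<in> h ` out_nbhd D x \<longleftrightarrow> y \<in> out_nbhd D x" if "y \<in> ?V" for y
      using inj_on_image_mem_iff[OF h that sub_out] .
    have ex: "(\<exists>u\<in>out_nbhd D x. (h u, h y) \<in> parcs D') \<longleftrightarrow>
        (\<exists>u\<in>out_nbhd D x. (u, y) \<in> parcs D)" if "y \<in> ?V" for y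
      using that arcs' sub_out by blast
    have "h y \<in> second_out_nbhd D' (h x) \<longleftrightarrow> y \<in> second_out_nbhd D x" if "y \<in> ?V" for y
      using x that by (simp add: second_out_nbhd_def out V' inj mem ex)
    moreover have "second_out_nbhd D' (h x) \<subseteq> h ` ?V" "second_out_nbhd D x \<subseteq> ?V"
      by (auto simp: second_out_nbhd_def V')
    ultimately have "second_out_nbhd D' (h x) = h ` second_out_nbhd D x"
      by blast
    moreover have "second_out_nbhd D x \<subseteq> ?V"
      by (auto simp: second_out_nbhd_def)
    ultimately have "Seymour_vertex D x"
      using w x out sub_out card_image[OF inj_on_subset[OF h]]
      by (simp add: Seymour_vertex_def)
    with D show False
      by blast
  qed
  ultimately show ?thesis
    by (auto simp: Seymour_free_orientable_def)
qed

section \<open>Independent coin flips\<close>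

lemma prob_pair_pmf_Times:
  "measure_pmf.prob (pair_pmf M N) (X \<times> Y) = measure_pmf.prob M X * measure_pmf.prob N Y"
proof -
  \<comment> \<open>Intersecting with the supports changes no probability and makes both factors
    countable.\<close>
  have "measure_pmf.prob (pair_pmf M N) (X \<times> Y) =
      measure_pmf.prob (pair_pmf M N) ((X \<times> Y) \<inter> set_pmf (pair_pmf M N))"
    by (simp only: measure_Int_set_pmf)
  also have "(X \<times> Y) \<inter> set_pmf (pair_pmf M N) = (X \<inter> set_pmf M) \<times> (Y \<inter> set_pmf N)"
    by auto
  also have "measure_pmf.prob (pair_pmf M N) \<dots> =
      measure_pmf.prob M (X \<inter> set_pmf M) * measure_pmf.prob N (Y \<inter> set_pmf N)"
    by (intro measure_pmf_prob_product countable_Int2 countable_set_pmf)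
  finally show ?thesis
    by (simp only: measure_Int_set_pmf)
qed

text \<open>Each coin shows the prescribed value with probability \<open>p\<close> or
  \<open>1 - p\<close>, hence at least their minimum, and independence multiplies these
  bounds.\<close>

lemma prob_Pi_bernoulli_avoids_pattern:
  fixes p :: real
  assumes "finite K" "p \<in> {0..1}"
  shows "measure_pmf.prob (Pi_pmf K d (\<lambda>_. bernoulli_pmf p)) {f. \<exists>x\<in>K. f x \<noteq> g x}
           \<le> 1 - min p (1 - p) ^ card K"
proof -
  let ?M = "Pi_pmf K d (\<lambda>_. bernoulli_pmf p)"
  have "min p (1 - p) ^ card K = (\<Prod>x\<in>K. min p (1 - p))"
    by simp
  also have "\<dots> \<le> (\<Prod>x\<in>K. measure_pmf.prob (bernoulli_pmf p) {g x})"
  proof (rule prod_mono)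
    fix x
    show "0 \<le> min p (1 - p) \<and> min p (1 - p) \<le> measure_pmf.prob (bernoulli_pmf p) {g x}"
      using assms by (cases "g x") (auto simp: measure_pmf_single)
  qed
  also have "\<dots> = measure_pmf.prob ?M (Pi K (\<lambda>x. {g x}))"
    using assms by (subst measure_Pi_pmf_Pi) auto
  also have "\<dots> = 1 - measure_pmf.prob ?M (- Pi K (\<lambda>x. {g x}))"
    using measure_pmf.prob_compl[of "Pi K (\<lambda>x. {g x})" ?M] by (simp add: Compl_eq_Diff_UNIV)
  also have "- Pi K (\<lambda>x. {g x}) = {f. \<exists>x\<in>K. f x \<noteq> g x}"
    by (auto simp: Pi_def)
  finally show ?thesis
    by linarith
qed

text \<open>Disjoint sets of coins are independent, so the failure probabilities multiply. The
  ground set \<open>A\<close> varies in the induction, since splitting off the coins in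
  \<open>K j\<close> leaves those in \<open>A - K j\<close>.\<close>

lemma prob_Pi_bernoulli_avoids_patterns:
  fixes p :: real
  assumes "finite L" "finite A" "p \<in> {0..1}"
    and "\<And>i. i \<in> L \<Longrightarrow> K i \<subseteq> A" "disjoint_family_on K L" "\<And>i. i \<in> L \<Longrightarrow> card (K i) = k"
  shows "measure_pmf.prob (Pi_pmf A d (\<lambda>_. bernoulli_pmf p)) {f. \<forall>i\<in>L. \<exists>x\<in>K i. f x \<noteq> g i x}
           \<le> (1 - min p (1 - p) ^ k) ^ card L"
  using assms
proof (induction L arbitrary: A rule: finite_induct)
  case (insert j L)
  let ?P = "\<lambda>A. Pi_pmf A d (\<lambda>_. bernoulli_pmf p)"
  let ?X = "{f. \<exists>x\<in>K j. f x \<noteq> g j x}" and ?Y = "{f. \<forall>i\<in>L. \<exists>x\<in>K i. f x \<noteq> g i x}"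
  let ?B = "A - K j"
  have K: "finite (K j)" "K j \<subseteq> A"
    using insert.prems finite_subset[of "K j" A] by auto
  have disj: "K i \<inter> K j = {}" if "i \<in> L" for i
    using insert.prems(4) insert.hyps that by (auto simp: disjoint_family_on_def)
  have "?P A = ?P (K j \<union> ?B)"
    using K by (simp add: Un_absorb1)
  also have "\<dots> = map_pmf (\<lambda>(f, h) x. if x \<in> K j then f x else h x) (pair_pmf (?P (K j)) (?P ?B))"
    using K insert.prems by (intro Pi_pmf_union) auto
  finally have "measure_pmf.prob (?P A) {f. \<forall>i\<in>insert j L. \<exists>x\<in>K i. f x \<noteq> g i x} =
      measure_pmf.prob (pair_pmf (?P (K j)) (?P ?B))
        ((\<lambda>(f, h) x. if x \<in> K j then f x else h x) -` {f. \<forall>i\<in>insert j L. \<exists>x\<in>K i. f x \<noteq> g i x})"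
    by (simp only: measure_map_pmf)
  \<comment> \<open>By disjointness, the patterns on the other sets \<open>K i\<close> are read off
    \<open>h\<close> alone, so the event is a rectangle.\<close>
  also have "(\<lambda>(f, h) x. if x \<in> K j then f x else h x) -`
      {f. \<forall>i\<in>insert j L. \<exists>x\<in>K i. f x \<noteq> g i x} = ?X \<times> ?Y"
    using disj by (auto simp: set_eq_iff disjoint_iff; metis)
  also have "measure_pmf.prob (pair_pmf (?P (K j)) (?P ?B)) (?X \<times> ?Y) =
      measure_pmf.prob (?P (K j)) ?X * measure_pmf.prob (?P ?B) ?Y"
    by (rule prob_pair_pmf_Times)
  also have "\<dots> \<le> (1 - min p (1 - p) ^ k) * (1 - min p (1 - p) ^ k) ^ card L"
  proof (intro mult_mono)
    show "measure_pmf.prob (?P (K j)) ?X \<le> 1 - min p (1 - p) ^ k"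
      using prob_Pi_bernoulli_avoids_pattern[OF K(1) insert.prems(2), of d "g j"] insert.prems(5)[of j]
      by simp
    show "measure_pmf.prob (?P ?B) ?Y \<le> (1 - min p (1 - p) ^ k) ^ card L"
      using insert.prems disj by (intro insert.IH) (auto simp: disjoint_family_on_def; blast)+
    show "0 \<le> 1 - min p (1 - p) ^ k"
      using insert.prems(2) by (auto intro!: power_le_one)
  qed simp
  finally show ?case
    using insert.hyps by simp
qed auto

text \<open>The number of successes in \<open>K\<close> is binomial with mean
  \<open>p * card K\<close>, so Hoeffding's inequality applies with relative deviation
  \<open>p - 1/2\<close>.\<close>

lemma prob_Pi_bernoulli_at_most_half:
  fixes p :: real
  assumes "finite A" "K \<subseteq> A" "K \<noteq> {}" "p \<in> {1/2..1}"
  shows "measure_pmf.prob (Pi_pmf A d (\<lambda>_. bernoulli_pmf p)) {f. 2 * card {x \<in> K. f x} \<le> card K}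
           \<le> exp (- 2 * (p - 1/2)\<^sup>2 * card K)"
proof -
  interpret binomial_distribution "card K" p
    using assms by unfold_locales auto
  have K: "finite K" "card K > 0"
    using assms finite_subset by (auto simp: card_gt_0_iff)
  have "binomial_pmf (card K) p = map_pmf (\<lambda>f. card {x \<in> K. f x}) (Pi_pmf K d (\<lambda>_. bernoulli_pmf p))"
    using assms K by (intro binomial_pmf_altdef') auto
  \<comment> \<open>The coins on \<open>K\<close> are the marginal of those on \<open>A\<close>,
    reset to the default \<open>d\<close> outside \<open>K\<close>.\<close>
  also have "Pi_pmf K d (\<lambda>_. bernoulli_pmf p) =
      map_pmf (\<lambda>f x. if x \<in> K then f x else d) (Pi_pmf A d (\<lambda>_. bernoulli_pmf p))"
    using assms by (intro Pi_pmf_subset) auto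
  finally have eq: "binomial_pmf (card K) p =
      map_pmf (\<lambda>f. card {x \<in> K. f x}) (Pi_pmf A d (\<lambda>_. bernoulli_pmf p))"
    by (simp add: pmf.map_comp o_def cong: conj_cong)
  have "measure_pmf.prob (Pi_pmf A d (\<lambda>_. bernoulli_pmf p)) {f. 2 * card {x \<in> K. f x} \<le> card K} =
      measure_pmf.prob (binomial_pmf (card K) p) {x. real x / card K \<le> p - (p - 1/2)}"
  proof -
    \<comment> \<open>The threshold 1/2 is written as mean minus deviation, the form that
      \<open>prob_le'\<close> takes.\<close>
    have "2 * x \<le> card K \<longleftrightarrow> real x / card K \<le> p - (p - 1/2)" for x
      using K(2) by (simp add: divide_le_eq) linarith
    then show ?thesis
      unfolding eq by simp
  qed
  also have "\<dots> \<le> exp (- 2 * real (card K) * (p - 1/2)\<^sup>2)"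
    using prob_le'[OF K(2), of "p - 1/2"] assms by simp
  finally show ?thesis
    by (simp add: mult_ac)
qed

section \<open>Random graphs\<close>

text \<open>The random graph as a function of its coins, so that events can be bounded directly in
  the product measure \<open>edge_coins\<close>.\<close>

definition edge_graph :: "nat \<Rightarrow> (nat set \<Rightarrow> bool) \<Rightarrow> nat pair_pre_digraph" where
  "edge_graph n f =
     \<lparr>pverts = {..<n}, parcs = {(u, v). {u, v} \<in> nsets {..<n} 2 \<and> f {u, v}}\<rparr>"

abbreviation edge_coins :: "nat \<Rightarrow> real \<Rightarrow> (nat set \<Rightarrow> bool) pmf" where
  "edge_coins n p \<equiv> Pi_pmf (nsets {..<n} 2) False (\<lambda>_. bernoulli_pmf p)"

lemma binomial_random_graph_eq: "binomial_random_graph n p = map_pmf (edge_graph n) (edge_coins n p)"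
  by (simp add: binomial_random_graph_def edge_graph_def[abs_def])

lemma pair_graph_edge_graph: "pair_graph (edge_graph n f)"
proof -
  have "parcs (edge_graph n f) \<subseteq> {..<n} \<times> {..<n}"
    by (auto simp: edge_graph_def)
  then have "finite (parcs (edge_graph n f))"
    by (rule finite_subset) simp
  moreover have "symmetric (with_proj (edge_graph n f))"
    by (auto simp: symmetric_def edge_graph_def insert_commute intro!: symI)
  ultimately show ?thesis
    by unfold_locales (auto simp: edge_graph_def)
qed

section \<open>Sparse cuts and the union bound over them\<close>

lemma prob_sparse_cut:
  fixes p :: real
  assumes p: "p \<in> {1/2..1}" and S: "S \<subset> {..<n}" "S \<noteq> {}"
  defines "W \<equiv> {..<n} - S"
  shows "measure_pmf.prob (edge_coins n p)
           {f. 2 * card (parcs (edge_graph n f) \<inter> W \<times> S) \<le> card W * card S}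
         \<le> exp (- 2 * (p - 1/2)\<^sup>2 * (card W * card S))"
proof -
  let ?e = "\<lambda>(v, u). {v, u :: nat}"
  define K where "K = ?e ` (W \<times> S)"
  \<comment> \<open>Since \<open>W\<close> and \<open>S\<close> are disjoint, an unordered pair
    across the cut determines which end lies in \<open>W\<close>. Cut arcs thus correspond to
    successful coins in \<open>K\<close>.\<close>
  have inj: "inj_on ?e (W \<times> S)"
    by (auto simp: inj_on_def W_def doubleton_eq_iff)
  have "card K = card W * card S"
    unfolding K_def by (subst card_image[OF inj]) (simp add: card_cartesian_product)
  moreover have "card {x \<in> K. f x} = card (parcs (edge_graph n f) \<inter> W \<times> S)" for f
  proof -
    have "{x \<in> K. f x} = ?e ` (parcs (edge_graph n f) \<inter> W \<times> S)"
      using S by (auto simp: K_def W_def edge_graph_def)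
    then show ?thesis
      by (simp add: card_image[OF inj_on_subset[OF inj]])
  qed
  moreover have "K \<subseteq> nsets {..<n} 2" "K \<noteq> {}"
    using S by (auto simp: K_def W_def)
  ultimately show ?thesis
    using prob_Pi_bernoulli_at_most_half[of "nsets {..<n} 2" K p False] p
    by (simp add: finite_imp_finite_nsets)
qed

text \<open>This expands the product of the factors \<open>r + 1\<close> over \<open>A\<close>; a
  subset records where \<open>r\<close> is chosen.\<close>

lemma sum_power_card_Pow:
  fixes r :: "'b :: comm_semiring_1"
  assumes "finite A"
  shows "(\<Sum>S\<in>Pow A. r ^ card S) = (1 + r) ^ card A"
  using prod_add[OF assms, of "\<lambda>_. r" "\<lambda>_. 1"] by (simp add: add.commute)

text \<open>The larger of \<open>k\<close> and \<open>l\<close> is at least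
  \<open>(k + l) / 2\<close>, so \<open>k * l\<close> is at least the smaller one times this mean;
  adding both powers avoids a case distinction later. For the two sides of a cut,
  \<open>k + l = n\<close>, and the base is the same for all cuts.\<close>

lemma exp_mult_le_sum_powers:
  fixes c :: real and k l :: nat
  assumes "c \<ge> 0"
  shows "exp (- c * (k * l)) \<le> exp (- c * (k + l) / 2) ^ k + exp (- c * (k + l) / 2) ^ l"
proof -
  have *: "exp (- c * (k * l)) \<le> exp (- c * (k + l) / 2) ^ k" if "k \<le> l" for k l :: nat
  proof -
    have "c * k * real k \<le> c * k * real l"
      using that assms by (intro mult_left_mono) auto
    then show ?thesis
      by (simp add: exp_of_nat_mult[symmetric] algebra_simps)
  qed
  show ?thesis
  proof (cases "k \<le> l")
    case True
    from *[OF True] show ?thesis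
      by (rule order_trans) simp
  next
    case False
    then have "l \<le> k" by simp
    from *[OF this] have "exp (- c * (k * l)) \<le> exp (- c * (k + l) / 2) ^ l"
      by (simp add: add.commute mult.commute)
    then show ?thesis
      by (rule order_trans) simp
  qed
qed

text \<open>Each cut contributes at most a power of \<open>r\<close> for either side. Summed over
  all cuts both kinds of terms give the same sum, whence the factor 2, and this sum is part of the
  expansion of \<open>(1 + r) ^ n\<close>.\<close>

lemma prob_not_dense_cuts:
  fixes p :: real
  assumes p: "p \<in> {1/2..1}"
  shows "measure_pmf.prob (edge_coins n p) {f. \<not> dense_cuts (edge_graph n f)}
           \<le> 2 * ((1 + exp (- (p - 1/2)\<^sup>2 * n)) ^ n - 1)"
proof -
  define r where "r = exp (- (p - 1/2)\<^sup>2 * n)"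
  define C where "C = {S. S \<subset> {..<n} \<and> S \<noteq> {}}"
  have fin: "finite C"
    by (rule finite_subset[of _ "Pow {..<n}"]) (auto simp: C_def)
  have compl: "(\<Sum>S\<in>C. r ^ card ({..<n} - S)) = (\<Sum>S\<in>C. r ^ card S)"
    by (rule sum.reindex_bij_witness[of _ "\<lambda>S. {..<n} - S" "\<lambda>S. {..<n} - S"]) (auto simp: C_def)
  have bound: "(\<Sum>S\<in>C. r ^ card S) \<le> (1 + r) ^ n - 1"
  proof -
    \<comment> \<open>Admitting the full vertex set only enlarges the sum. Omitting the empty set
      saves the term 1, without which the bound would not tend to 0.\<close>
    have "(\<Sum>S\<in>C. r ^ card S) \<le> (\<Sum>S\<in>Pow {..<n} - {{}}. r ^ card S)"
      by (intro sum_mono2) (auto simp: C_def r_def)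
    also have "\<dots> = (1 + r) ^ n - 1"
      by (simp add: sum_diff1 sum_power_card_Pow)
    finally show ?thesis .
  qed
  have "{f. \<not> dense_cuts (edge_graph n f)} \<subseteq> (\<Union>S\<in>C. {f. 2 * card (parcs (edge_graph n f) \<inter>
      ({..<n} - S) \<times> S) \<le> card ({..<n} - S) * card S})"
    by (auto simp: dense_cuts_def C_def edge_graph_def not_less)
  then have "measure_pmf.prob (edge_coins n p) {f. \<not> dense_cuts (edge_graph n f)} \<le>
      measure_pmf.prob (edge_coins n p) (\<Union>S\<in>C. {f. 2 * card (parcs (edge_graph n f) \<inter>
        ({..<n} - S) \<times> S) \<le> card ({..<n} - S) * card S})"
    by (intro measure_pmf.finite_measure_mono) auto
  also have "\<dots> \<le> (\<Sum>S\<in>C. measure_pmf.prob (edge_coins n p) {f. 2 * card (parcs (edge_graph n f) \<inter>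
        ({..<n} - S) \<times> S) \<le> card ({..<n} - S) * card S})"
    using fin by (intro measure_pmf.finite_measure_subadditive_finite) auto
  also have "\<dots> \<le> (\<Sum>S\<in>C. r ^ card ({..<n} - S) + r ^ card S)"
  proof (rule sum_mono)
    fix S assume "S \<in> C"
    then have S: "S \<subset> {..<n}" "S \<noteq> {}"
      by (auto simp: C_def)
    let ?k = "card ({..<n} - S)" and ?c = "2 * (p - 1/2)\<^sup>2"
    have "card ({..<n} - S) = n - card S" "card S \<le> n"
      using S finite_subset[of S "{..<n}"] card_mono[of "{..<n}" S] by (auto simp: card_Diff_subset)
    then have n: "?k + card S = n"
      by simp
    have "measure_pmf.prob (edge_coins n p)
           {f. 2 * card (parcs (edge_graph n f) \<inter> ({..<n} - S) \<times> S) \<le> ?k * card S}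
         \<le> exp (- ?c * (?k * card S))"
      using prob_sparse_cut[OF p S] by simp
    also have "\<dots> \<le> exp (- ?c * (?k + card S) / 2) ^ ?k + exp (- ?c * (?k + card S) / 2) ^ card S"
      by (intro exp_mult_le_sum_powers) simp
    \<comment> \<open>The 2 from Hoeffding's exponent cancels the halving of
      \<open>n\<close>.\<close>
    also have "exp (- ?c * (?k + card S) / 2) = r"
      using n by (simp add: r_def flip: of_nat_add)
    finally show "measure_pmf.prob (edge_coins n p)
           {f. 2 * card (parcs (edge_graph n f) \<inter> ({..<n} - S) \<times> S) \<le> ?k * card S}
         \<le> r ^ ?k + r ^ card S" .
  qed
  also have "\<dots> \<le> 2 * ((1 + r) ^ n - 1)"
    using bound compl by (simp add: sum.distrib)
  finally show ?thesis
    by (simp add: r_def)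
qed

section \<open>Copies of the counterexample in independent blocks\<close>

lemma prob_no_Seymour_free_orientable_subset:
  fixes p :: real and D :: "'a pair_pre_digraph"
  assumes p: "p \<in> {0..1}"
    and D: "oriented_graph D" "\<not> (\<exists>v. Seymour_vertex D v)" "pverts D \<noteq> {}"
  defines "m \<equiv> card (pverts D)"
  shows "measure_pmf.prob (edge_coins n p)
           {f. \<forall>S. S \<subseteq> {..<n} \<longrightarrow> S \<noteq> {} \<longrightarrow> \<not> Seymour_free_orientable (induced (edge_graph n f) S)}
         \<le> (1 - min p (1 - p) ^ (m choose 2)) ^ (n div m)"
proof -
  let ?V = "pverts D"
  have fin: "finite ?V" and sub: "parcs D \<subseteq> ?V \<times> ?V" and asym: "asym (parcs D)"
    using D by (auto simp: oriented_graph_iff)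
  obtain g where g: "bij_betw g ?V {..<m}"
    using ex_bij_betw_finite_nat[OF fin] by (auto simp: m_def lessThan_atLeast0)
  \<comment> \<open>Block \<open>i\<close> is the interval of \<open>m\<close> integers from
    \<open>i * m\<close>. The map \<open>h i\<close> places \<open>D\<close> there,
    \<open>K i\<close> holds the coins inside the block, and \<open>pat i\<close> is the outcome
    making the block an induced copy.\<close>
  define h where "h i x = i * m + g x" for i x
  define K where "K i = nsets {i * m..<i * m + m} 2" for i :: nat
  define pat where "pat i e \<longleftrightarrow> (\<exists>(x, y)\<in>parcs D. e = {h i x, h i y})" for i e
  have inj: "inj_on (h i) ?V" for i
    using g by (auto simp: h_def bij_betw_def inj_on_def)
  have h: "h i x \<in> {i * m..<i * m + m}" if "x \<in> ?V" for i x
    using bij_betwE[OF g] that by (auto simp: h_def)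
  have block: "i * m + m \<le> n" if "i < n div m" for i
  proof -
    have "Suc i * m \<le> n div m * m"
      using that by (intro mult_le_mono1) simp
    also have "\<dots> \<le> n"
      by simp
    finally show ?thesis
      by simp
  qed
  \<comment> \<open>A block whose coins all agree with \<open>pat i\<close> would carry a
    Seymour-free orientation.\<close>
  have "\<exists>x\<in>K i. f x \<noteq> pat i x"
    if i: "i < n div m"
      and f: "\<forall>S. S \<subseteq> {..<n} \<longrightarrow> S \<noteq> {} \<longrightarrow> \<not> Seymour_free_orientable (induced (edge_graph n f) S)"
    for f i
  proof (rule ccontr)
    assume "\<not> ?thesis"
    then have f_eq: "f e = pat i e" if "e \<in> K i" for e
      using that by blast
    have "(h i x, h i y) \<in> parcs (edge_graph n f) \<longleftrightarrow> (x, y) \<in> parcs D \<or> (y, x) \<in> parcs D"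
      if xy: "x \<in> ?V" "y \<in> ?V" for x y
    proof (cases "x = y")
      \<comment> \<open>Both sides fail: a singleton is not a 2-set, and asymmetry forbids loops in
        \<open>D\<close>.\<close>
      case True
      then show ?thesis
        using asymD[OF asym] by (auto simp: edge_graph_def)
    next
      case False
      then have neq: "h i x \<noteq> h i y"
        using inj xy by (auto simp: inj_on_def)
      have "(h i x, h i y) \<in> parcs (edge_graph n f) \<longleftrightarrow> f {h i x, h i y}"
        using neq h[OF xy(1), of i] h[OF xy(2), of i] block[OF i] by (simp add: edge_graph_def)
      also have "\<dots> \<longleftrightarrow> pat i {h i x, h i y}"
        using neq h xy by (intro f_eq) (simp add: K_def)
      also have "\<dots> \<longleftrightarrow> (x, y) \<in> parcs D \<or> (y, x) \<in> parcs D"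
      proof
        assume "pat i {h i x, h i y}"
        then obtain a b where ab: "(a, b) \<in> parcs D" "{h i x, h i y} = {h i a, h i b}"
          by (auto simp: pat_def)
        then have "a \<in> ?V" "b \<in> ?V"
          using sub by auto
        then show "(x, y) \<in> parcs D \<or> (y, x) \<in> parcs D"
          using ab xy inj[of i] by (auto simp: doubleton_eq_iff inj_on_eq_iff)
      qed (auto simp: pat_def insert_commute)
      finally show ?thesis .
    qed
    then have "Seymour_free_orientable (induced (edge_graph n f) (h i ` ?V))"
      by (intro Seymour_free_orientable_embedding[OF D(1,2) inj])
    moreover have "h i ` ?V \<subseteq> {..<n}"
      using h[of _ i] block[OF i] by fastforce
    ultimately show False
      using f D(3) by blast
  qed
  then have "measure_pmf.prob (edge_coins n p)
      {f. \<forall>S. S \<subseteq> {..<n} \<longrightarrow> S \<noteq> {} \<longrightarrow> \<not> Seymour_free_orientable (induced (edge_graph n f) S)}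
      \<le> measure_pmf.prob (edge_coins n p) {f. \<forall>i\<in>{..<n div m}. \<exists>x\<in>K i. f x \<noteq> pat i x}"
    by (intro measure_pmf.finite_measure_mono) auto
  also have "\<dots> \<le> (1 - min p (1 - p) ^ (m choose 2)) ^ card {..<n div m}"
  proof (rule prob_Pi_bernoulli_avoids_patterns)
    show "K i \<subseteq> nsets {..<n} 2" if "i \<in> {..<n div m}" for i
      using block[of i] that unfolding K_def by (intro nsets_mono) auto
    \<comment> \<open>Distinct blocks share no vertex, hence no pair.\<close>
    have "K i \<inter> K j = {}" if "i < j" for i j
    proof -
      have "Suc i * m \<le> j * m"
        using that by (intro mult_le_mono1) simp
      then have "x \<notin> {j * m..<j * m + m}" if "x \<in> {i * m..<i * m + m}" for x
        using that by simp
      then show ?thesis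
        unfolding K_def nsets_2_eq by (auto simp: doubleton_eq_iff)
    qed
    then show "disjoint_family_on K {..<n div m}"
      by (metis disjoint_family_on_def inf_commute nat_neq_iff)
  qed (use p in \<open>auto simp: K_def finite_imp_finite_nsets\<close>)
  finally show ?thesis
    by simp
qed

theorem theorem1p3:
  fixes p :: real
  assumes "p \<in> {1/2<..<1}"
    and "\<exists>D :: 'a pair_pre_digraph.
           oriented_graph D \<and> pverts D \<noteq> {} \<and> \<not> (\<exists>v. Seymour_vertex D v)"
  shows "(\<lambda>n. measure_pmf.prob (binomial_random_graph n p)
           {G. \<exists>D. orientation_of G D \<and> \<not> (\<exists>v. Seymour_vertex D v)}) \<longlonglongrightarrow> 1"
proof -
  obtain D :: "'a pair_pre_digraph" where D: "oriented_graph D" "\<not> (\<exists>v. Seymour_vertex D v)"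
    "pverts D \<noteq> {}"
    using assms(2) by blast
  define m where "m = card (pverts D)"
  define q where "q = min p (1 - p) ^ (m choose 2)"
  define c where "c = (p - 1/2)\<^sup>2"
  have m: "m > 0"
    using D by (simp add: m_def card_gt_0_iff oriented_graph_iff)
  \<comment> \<open>Here \<open>p < 1\<close> enters: the non-edges of the counterexample must be
    attainable too.\<close>
  have q: "0 < q" "q \<le> 1"
    using assms(1) by (auto simp: q_def intro!: power_le_one)
  have c: "c > 0"
    using assms(1) by (simp add: c_def)
  have lower: "1 - (2 * ((1 + exp (- c * n)) ^ n - 1) + (1 - q) ^ (n div m)) \<le>
      measure_pmf.prob (binomial_random_graph n p)
        {G. \<exists>D. orientation_of G D \<and> \<not> (\<exists>v. Seymour_vertex D v)}" for n
  proof -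
    let ?good = "{f. Seymour_free_orientable (edge_graph n f)}"
    let ?sparse = "{f. \<not> dense_cuts (edge_graph n f)}"
    let ?none = "{f. \<forall>S. S \<subseteq> {..<n} \<longrightarrow> S \<noteq> {} \<longrightarrow>
      \<not> Seymour_free_orientable (induced (edge_graph n f) S)}"
    have verts: "pverts (edge_graph n f) = {..<n}" for f
      by (simp add: edge_graph_def)
    \<comment> \<open>With dense cuts, any nonempty orientable induced subgraph grows to the whole
      graph, so failure requires one of the two bad events.\<close>
    have "- ?good \<subseteq> ?sparse \<union> ?none"
      using Seymour_free_orientable_if_dense_cuts[OF pair_graph_edge_graph, of n, unfolded verts]
      by blast
    then have "measure_pmf.prob (edge_coins n p) (- ?good) \<le>
        measure_pmf.prob (edge_coins n p) (?sparse \<union> ?none)"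
      by (intro measure_pmf.finite_measure_mono) auto
    also have "\<dots> \<le> measure_pmf.prob (edge_coins n p) ?sparse +
        measure_pmf.prob (edge_coins n p) ?none"
      by (intro measure_Un_le) auto
    also have "\<dots> \<le> 2 * ((1 + exp (- c * n)) ^ n - 1) + (1 - q) ^ (n div m)"
      unfolding c_def q_def m_def using assms(1) D
      by (intro add_mono prob_not_dense_cuts prob_no_Seymour_free_orientable_subset) auto
    finally have "1 - (2 * ((1 + exp (- c * n)) ^ n - 1) + (1 - q) ^ (n div m)) \<le>
        measure_pmf.prob (edge_coins n p) ?good"
      using measure_pmf.prob_compl[of ?good "edge_coins n p"] by (simp add: Compl_eq_Diff_UNIV)
    then show ?thesis
      by (simp add: binomial_random_graph_eq vimage_def Seymour_free_orientable_def)
  qed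
  \<comment> \<open>The success probability \<open>q\<close> per block is constant while the number
    of blocks grows without bound.\<close>
  have "(\<lambda>n. (1 - q) ^ n) \<longlonglongrightarrow> 0"
    using q by (intro LIMSEQ_power_zero) auto
  then have "(\<lambda>n. (1 - q) ^ (n div m)) \<longlonglongrightarrow> 0"
    by (rule filterlim_compose) (rule filterlim_at_top_div_const_nat[OF m])
  \<comment> \<open>The limit holds because \<open>n * exp (- c * n)\<close> tends to 0.\<close>
  moreover have "(\<lambda>n. (1 + exp (- c * real n)) ^ n) \<longlonglongrightarrow> 1"
    using c by real_asymp
  ultimately have "(\<lambda>n. 1 - (2 * ((1 + exp (- c * real n)) ^ n - 1) + (1 - q) ^ (n div m)))
      \<longlonglongrightarrow> 1 - (2 * (1 - 1) + 0)"
    by (intro tendsto_intros)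
  then have "(\<lambda>n. 1 - (2 * ((1 + exp (- c * real n)) ^ n - 1) + (1 - q) ^ (n div m))) \<longlonglongrightarrow> 1"
    by simp
  then show ?thesis
    by (rule tendsto_sandwich[where h = "\<lambda>_. 1", rotated 2])
       (simp_all only: lower measure_pmf.prob_le_1 eventually_True tendsto_const)
qed

end
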